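(* Let $\mathscr T=(V,E)$ be a rooted directed tree with root $\mathsf{root}$ and let $\mathscr T_\infty$ be the extended directed tree associated with $\mathscr T$, with vertex set $V_\infty=V\sqcup\{\infty\}$. For $u\in V$, $b\in V\setminus\{u\}$ and a weight system $\lambda_u=\{\lambda_{uv}\}_{v\in V_\infty}$ of complex numbers, let $D_{\lambda_u}$ be the diagonal operator on $\mathscr T$ and let $W^{(b)}_{\lambda_u}$ be the weighted join operator on $\mathscr T$. Consider the closed subspace $\mathscr H^{(b)}_u$ of $\ell^2(V)$ given by $$\mathscr H^{(b)}_u=\begin{cases}\ell^2(\mathsf{Asc}(u)\cup\mathsf{Des}_b(u))&\text{if } b\in\mathsf{Des}(u),\\ \ell^2(\mathsf{Des}_u(u))&\text{otherwise.}\end{cases}$$ Then: (i) $W^{(b)}_{\lambda_u}$ admits the decomposition $W^{(b)}_{\lambda_u}=D^{(b)}_{\lambda_u}\oplus N^{(b)}_{\lambda_u}$ on $\ell^2(V)=\mathscr H^{(b)}_u\oplus(\ell^2(V)\ominus\mathscr H^{(b)}_u)$, where $D^{(b)}_{\lambda_u}$ is a densely defined diagonal operator in $\mathscr H^{(b)}_u$ and $N^{(b)}_{\lambda_u}$ is a bounded linear operator of rank at most one on $\ell^2(V)\ominus\mathscr H^{(b)}_u$. (ii) $D^{(b)}_{\lambda_u}$ and $N^{(b)}_{\lambda_u}$ are given by $$D^{(b)}_{\lambda_u}=D_{\lambda_u}|_{\mathscr H^{(b)}_u},\quad \mathscr D(D^{(b)}_{\lambda_u})=\{f\in\mathscr H^{(b)}_u:D_{\lambda_u}(f\oplus0)\in\mathscr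 H^{(b)}_u\},\qquad N^{(b)}_{\lambda_u}=e_u\otimes e_{\lambda_u,A_u},$$ where $e_{\lambda_u,A_u}=\sum_{v\in A_u}\overline{\lambda_{uv}}\,e_v$ and $A_u=[u,b]$ if $b\in\mathsf{Des}(u)$, $A_u=\mathsf{Asc}(u)\cup\{b,u\}$ otherwise.
   Context: Trees. A directed tree $\mathscr T=(V,E)$ is a directed graph (no loops, $V$ and $E$ nonempty) which has no circuits, is connected (ignoring orientation), and in which every non-root vertex $v$ has exactly one parent $\mathsf{par}(v)$ (the $p$ with $(p,v)\in E$); a root is a vertex with no parent, and $\mathscr T$ is rooted if it has a unique root $\mathsf{root}$. Throughout $\mathrm{card}(V)=\aleph_0$. $\mathsf{Des}(u)\subseteq V$ is the set of descendants of $u$, including $u$; $\mathsf{Asc}(u)=\{\mathsf{par}^{\langle n\rangle}(u):n\ge1\}$. The depth $\mathsf d_u$ is the length of the directed path from $\mathsf{root}$ to $u$. For $v\in\mathsf{Des}(u)$, $[u,v]$ is the set of vertices of the directed path from $u$ to $v$ and $\mathsf{Des}_v(u)=\mathsf{Des}(u)\setminus[u,v]$; so $\mathsf{Des}_u(u)=\mathsf{Des}(u)\setminus\{u\}$. Join operations. The extended tree $\mathscr T_\infty$ has vertex set $V_\infty=V\sqcup\{\infty\}$ and in it $\infty$ is declared a child (hence a descendant) of every $v\in V$. For $u,v\in V_\infty$: $u\sqcup v=u$ if $u$ is a descendant of $v$; $=v$ if $v$ is a descendant of $u$; $=\infty$ otherwise. For $u,v\in V$, $u\sqcap v$ is the vertex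 of largest depth among $\{w\in V:\mathsf{par}^{\langle n\rangle}(u)=w=\mathsf{par}^{\langle m\rangle}(v)\text{ for some }m,n\ge0\}$. For $b\in V$: $u\sqcup_bv=u\sqcap v$ if $u,v\in\mathsf{Asc}(b)$; $=u$ if $v=b$; $=v$ if $u=b$; $=u\sqcup v$ otherwise. Operators. A weight system is a family $\{\lambda_{uv}\}_{v\in V_\infty}\subseteq\mathbb C$ with $\lambda_{u\infty}=0$. $W^{(b)}_{\lambda_u}$ is the operator in $\ell^2(V)$ with domain $\{f\in\ell^2(V):\Lambda^{(b)}_uf\in\ell^2(V)\}$ and $W^{(b)}_{\lambda_u}f=\Lambda^{(b)}_uf$, where $(\Lambda^{(b)}_uf)(w)=\sum_{v\in V:\,u\sqcup_bv=w}\lambda_{uv}f(v)$, $w\in V$. $D_{\lambda_u}$ is the diagonal operator $D_{\lambda_u}f=\sum_{v}\lambda_{uv}f(v)e_v$ with domain $\{f\in\ell^2(V):\sum_v|f(v)|^2|\lambda_{uv}|^2<\infty\}$. $\{e_v\}$ is the standard orthonormal basis, $\ell^2(W)$ for $W\subseteq V$ is viewed as a subspace of $\ell^2(V)$, and $(x\otimes y)(h)=\langle h,y\rangle x$. *)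

theory Defs
  imports "HOL-Analysis.Analysis" "HOL-Library.Function_Algebras"
begin

section \<open>Directed trees\<close>

definition tree_roots :: "'a set \<Rightarrow> 'a rel \<Rightarrow> 'a set" where
  "tree_roots V E = {r \<in> V. \<nexists>p. (p, r) \<in> E}"

text \<open>Acyclicity excludes both loops and circuits.\<close>

definition directed_tree :: "'a set \<Rightarrow> 'a rel \<Rightarrow> bool" where
  "directed_tree V E \<longleftrightarrow>
     V \<noteq> {} \<and> E \<noteq> {} \<and> E \<subseteq> V \<times> V \<and> acyclic E \<and>
     (\<forall>u\<in>V. \<forall>v\<in>V. (u, v) \<in> (E \<union> E\<inverse>)\<^sup>*) \<and>
     (\<forall>v \<in> V - tree_roots V E. \<exists>!p. (p, v) \<in> E)"

definition rooted_directed_tree :: "'a set \<Rightarrow> 'a rel \<Rightarrow> bool" where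
  "rooted_directed_tree V E \<longleftrightarrow> directed_tree V E \<and> (\<exists>!r. r \<in> tree_roots V E)"

definition tree_root :: "'a set \<Rightarrow> 'a rel \<Rightarrow> 'a" where
  "tree_root V E = (THE r. r \<in> tree_roots V E)"

text \<open>The parent function is partial: it is undefined (\<open>None\<close>) at the root.\<close>

definition par :: "'a rel \<Rightarrow> 'a \<Rightarrow> 'a option" where
  "par E v = (if \<exists>p. (p, v) \<in> E then Some (THE p. (p, v) \<in> E) else None)"

primrec par_pow :: "'a rel \<Rightarrow> nat \<Rightarrow> 'a \<Rightarrow> 'a option" where
  "par_pow E 0 v = Some v"
| "par_pow E (Suc n) v = Option.bind (par_pow E n v) (par E)"

definition Asc :: "'a rel \<Rightarrow> 'a \<Rightarrow> 'a set" where
  "Asc E u = {w. \<exists>n\<ge>1. par_pow E n u = Some w}"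

definition Des :: "'a set \<Rightarrow> 'a rel \<Rightarrow> 'a \<Rightarrow> 'a set" where
  "Des V E u = {v \<in> V. (u, v) \<in> E\<^sup>*}"

definition is_dipath :: "'a rel \<Rightarrow> 'a \<Rightarrow> 'a \<Rightarrow> 'a list \<Rightarrow> bool" where
  "is_dipath E u v p \<longleftrightarrow>
     p \<noteq> [] \<and> hd p = u \<and> last p = v \<and> successively (\<lambda>x y. (x, y) \<in> E) p"

text \<open>In a directed tree there is exactly one directed path from a vertex to a given descendant;
  \<open>dipath\<close> is only meaningful in that case.\<close>

definition dipath :: "'a rel \<Rightarrow> 'a \<Rightarrow> 'a \<Rightarrow> 'a list" where
  "dipath E u v = (THE p. is_dipath E u v p)"

definition depth :: "'a set \<Rightarrow> 'a rel \<Rightarrow> 'a \<Rightarrow> nat" where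
  "depth V E u = length (dipath E (tree_root V E) u) - 1"

definition seg :: "'a rel \<Rightarrow> 'a \<Rightarrow> 'a \<Rightarrow> 'a set" where
  "seg E u v = set (dipath E u v)"

text \<open>\<open>Des_off V E v u\<close> is the set written $\mathsf{Des}_v(u)$.\<close>

definition Des_off :: "'a set \<Rightarrow> 'a rel \<Rightarrow> 'a \<Rightarrow> 'a \<Rightarrow> 'a set" where
  "Des_off V E v u = Des V E u - seg E u v"


section \<open>The extended tree and the join operations\<close>

datatype 'a evertex = Vert (the_vert: 'a) | Infty

definition ext_edges :: "'a set \<Rightarrow> 'a rel \<Rightarrow> 'a evertex rel" where
  "ext_edges V E = {(Vert u, Vert v) |u v. (u, v) \<in> E} \<union> {(Vert v, Infty) |v. v \<in> V}"

definition join :: "'a set \<Rightarrow> 'a rel \<Rightarrow> 'a evertex \<Rightarrow> 'a evertex \<Rightarrow> 'a evertex" where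
  "join V E x y =
     (if (y, x) \<in> (ext_edges V E)\<^sup>* then x
      else if (x, y) \<in> (ext_edges V E)\<^sup>* then y
      else Infty)"

definition meet :: "'a set \<Rightarrow> 'a rel \<Rightarrow> 'a \<Rightarrow> 'a \<Rightarrow> 'a" where
  "meet V E u v =
     (ARG_MAX (depth V E) w.
        w \<in> V \<and> (\<exists>m n. par_pow E n u = Some w \<and> par_pow E m v = Some w))"

text \<open>\<open>join_at V E b\<close> is the operation $\sqcup_b$ for a vertex $b \in V$.\<close>

definition join_at ::
  "'a set \<Rightarrow> 'a rel \<Rightarrow> 'a \<Rightarrow> 'a evertex \<Rightarrow> 'a evertex \<Rightarrow> 'a evertex" where
  "join_at V E b x y =
     (if x \<in> Vert ` Asc E b \<and> y \<in> Vert ` Asc E b then Vert (meet V E (the_vert x) (the_vert y))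
      else if y = Vert b then x
      else if x = Vert b then y
      else join V E x y)"


section \<open>Square-summable functions\<close>

text \<open>Elements of $\ell^2(W)$ are functions on the whole type that vanish off \<open>W\<close>. Thus
  \<open>ell2 W \<subseteq> ell2 V\<close> for \<open>W \<subseteq> V\<close>, and \<open>f \<oplus> 0\<close> is \<open>f\<close> itself.\<close>

definition ell2 :: "'a set \<Rightarrow> ('a \<Rightarrow> complex) set" where
  "ell2 W = {f. (\<forall>v. v \<notin> W \<longrightarrow> f v = 0) \<and> (\<lambda>v. (cmod (f v))\<^sup>2) summable_on UNIV}"

definition ell2_inner :: "('a \<Rightarrow> complex) \<Rightarrow> ('a \<Rightarrow> complex) \<Rightarrow> complex" where
  "ell2_inner f g = (\<Sum>\<^sub>\<infinity>v. f v * cnj (g v))"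

definition ell2_norm :: "('a \<Rightarrow> complex) \<Rightarrow> real" where
  "ell2_norm f = sqrt (\<Sum>\<^sub>\<infinity>v. (cmod (f v))\<^sup>2)"

definition cscale :: "complex \<Rightarrow> ('a \<Rightarrow> complex) \<Rightarrow> ('a \<Rightarrow> complex)" where
  "cscale c f = (\<lambda>v. c * f v)"

definition basis_vec :: "'a \<Rightarrow> ('a \<Rightarrow> complex)" where
  "basis_vec v = (\<lambda>w. if w = v then 1 else 0)"

definition ominus :: "('a \<Rightarrow> complex) set \<Rightarrow> ('a \<Rightarrow> complex) set \<Rightarrow> ('a \<Rightarrow> complex) set" where
  "ominus L H = {g \<in> L. \<forall>f\<in>H. ell2_inner g f = 0}"


section \<open>Operators\<close>

text \<open>A possibly unbounded operator is identified with its graph, so equality of operators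
  includes equality of their domains; the domain of \<open>T\<close> is \<open>Domain T\<close>.\<close>

type_synonym 'a operator = "('a \<Rightarrow> complex) rel"

definition linear_operator_in :: "('a \<Rightarrow> complex) set \<Rightarrow> 'a operator \<Rightarrow> bool" where
  "linear_operator_in H T \<longleftrightarrow>
     T \<subseteq> H \<times> H \<and> single_valued T \<and> (0, 0) \<in> T \<and>
     (\<forall>f f' g g'. (f, f') \<in> T \<and> (g, g') \<in> T \<longrightarrow> (f + g, f' + g') \<in> T) \<and>
     (\<forall>c f f'. (f, f') \<in> T \<longrightarrow> (cscale c f, cscale c f') \<in> T)"

definition densely_defined_in :: "('a \<Rightarrow> complex) set \<Rightarrow> 'a operator \<Rightarrow> bool" where
  "densely_defined_in H T \<longleftrightarrow>
     Domain T \<subseteq> H \<and> (\<forall>f\<in>H. \<forall>\<epsilon>>0. \<exists>g\<in>Domain T. ell2_norm (f - g) < \<epsilon>)"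

definition bounded_operator_on :: "('a \<Rightarrow> complex) set \<Rightarrow> 'a operator \<Rightarrow> bool" where
  "bounded_operator_on H T \<longleftrightarrow>
     linear_operator_in H T \<and> Domain T = H \<and>
     (\<exists>C. \<forall>(f, g)\<in>T. ell2_norm g \<le> C * ell2_norm f)"

text \<open>The rank is bounded through spanning sets because the library dimension of an
  infinite-dimensional space is \<open>0\<close>.\<close>

definition rank_at_most :: "nat \<Rightarrow> 'a operator \<Rightarrow> bool" where
  "rank_at_most n T \<longleftrightarrow>
     (\<exists>B. finite B \<and> card B \<le> n \<and> Range T \<subseteq> module.span cscale B)"

definition operator_sum :: "'a operator \<Rightarrow> 'a operator \<Rightarrow> 'a operator" where
  "operator_sum S T = {(f + g, f' + g') |f g f' g'. (f, f') \<in> S \<and> (g, g') \<in> T}"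

text \<open>The operator $x \otimes y$ on the subspace \<open>K\<close>.\<close>

definition rank_one_op ::
  "('a \<Rightarrow> complex) set \<Rightarrow> ('a \<Rightarrow> complex) \<Rightarrow> ('a \<Rightarrow> complex) \<Rightarrow> 'a operator" where
  "rank_one_op K x y = {(h, cscale (ell2_inner h y) x) |h. h \<in> K}"

definition diag_op :: "'a set \<Rightarrow> ('a \<Rightarrow> complex) \<Rightarrow> 'a operator" where
  "diag_op W \<mu> =
     {(f, \<lambda>v. \<mu> v * f v) |f. f \<in> ell2 W \<and> (\<lambda>v. (cmod (f v))\<^sup>2 * (cmod (\<mu> v))\<^sup>2) summable_on W}"

text \<open>An operator in $\ell^2(W)$ is diagonal if it is diagonal with respect to the standard
  orthonormal basis of $\ell^2(W)$.\<close>

definition diagonal_operator_in :: "'a set \<Rightarrow> 'a operator \<Rightarrow> bool" where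
  "diagonal_operator_in W T \<longleftrightarrow> (\<exists>\<mu>. T = diag_op W \<mu>)"


section \<open>Weighted join operators\<close>

text \<open>A weight system is given for a fixed vertex \<open>u\<close>: \<open>lam (Vert v)\<close> is $\lambda_{uv}$ and
  \<open>lam Infty\<close> is $\lambda_{u\infty}$.\<close>

definition weight_system :: "('a evertex \<Rightarrow> complex) \<Rightarrow> bool" where
  "weight_system lam \<longleftrightarrow> lam Infty = 0"

definition join_map ::
  "'a set \<Rightarrow> 'a rel \<Rightarrow> 'a \<Rightarrow> 'a \<Rightarrow> ('a evertex \<Rightarrow> complex) \<Rightarrow> ('a \<Rightarrow> complex) \<Rightarrow> ('a \<Rightarrow> complex)" where
  "join_map V E b u lam f =
     (\<lambda>w. if w \<in> V
          then \<Sum>\<^sub>\<infinity>v \<in> {v \<in> V. join_at V E b (Vert u) (Vert v) = Vert w}. lam (Vert v) * f v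
          else 0)"

definition weighted_join_op ::
  "'a set \<Rightarrow> 'a rel \<Rightarrow> 'a \<Rightarrow> 'a \<Rightarrow> ('a evertex \<Rightarrow> complex) \<Rightarrow> 'a operator" where
  "weighted_join_op V E b u lam =
     {(f, join_map V E b u lam f) |f. f \<in> ell2 V \<and> join_map V E b u lam f \<in> ell2 V}"

definition weight_diag_op :: "'a set \<Rightarrow> ('a evertex \<Rightarrow> complex) \<Rightarrow> 'a operator" where
  "weight_diag_op V lam = diag_op V (\<lambda>v. lam (Vert v))"

definition diag_support :: "'a set \<Rightarrow> 'a rel \<Rightarrow> 'a \<Rightarrow> 'a \<Rightarrow> 'a set" where
  "diag_support V E b u =
     (if b \<in> Des V E u then Asc E u \<union> Des_off V E b u else Des_off V E u u)"

definition A_set :: "'a set \<Rightarrow> 'a rel \<Rightarrow> 'a \<Rightarrow> 'a \<Rightarrow> 'a set" where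
  "A_set V E b u = (if b \<in> Des V E u then seg E u b else Asc E u \<union> {b, u})"

text \<open>Used only for finite \<open>A\<close>; \<open>A_set V E b u\<close> is always finite in a rooted directed tree.\<close>

definition weight_vec :: "('a evertex \<Rightarrow> complex) \<Rightarrow> 'a set \<Rightarrow> ('a \<Rightarrow> complex)" where
  "weight_vec lam A = (\<Sum>v\<in>A. cscale (cnj (lam (Vert v))) (basis_vec v))"

end

theory Submission
  imports Defs
begin

text \<open>The map \<open>v \<mapsto> u \<squnion>\<^sub>b v\<close> is almost the identity: it collapses a set \<open>A\<^sub>u\<close> of vertices to the
  single vertex \<open>u\<close>, fixes every vertex of a set \<open>W\<close> disjoint from \<open>A\<^sub>u\<close>, and sends all other
  vertices to infinity, where they contribute nothing (\<open>join_at_eq\<close>). Here \<open>A\<^sub>u\<close> is finite, because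
  every vertex of a rooted tree has only finitely many ancestors, and \<open>W\<close>
  is the set that carries the diagonal part. Summing over the fibres of this map gives
  \[ \Lambda_u^{(b)} f = \sum_{w \in W} \lambda_{uw} f(w) e_w
       + \Bigl(\sum_{v \in A_u} \lambda_{uv} f(v)\Bigr) e_u \]
  (\<open>join_map_eq\<close>). The first summand depends only on the values of \<open>f\<close> on \<open>W\<close>, the second only on
  those on \<open>A\<^sub>u\<close>, which lies off \<open>W\<close>. As the orthogonal complement of the functions supported in
  \<open>W\<close> consists of the functions supported off \<open>W\<close>, the operator splits into a diagonal one and the
  rank one operator of a finitely supported functional.

  Only the diagonal part can be unbounded: the second summand is a multiple of \<open>e\<^sub>u\<close>, so the image
  is square-summable exactly if the first summand is. Hence the domain of the weighted join
  operator is the sum of the domain of the diagonal part and the whole complement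
  (\<open>diag_plus_rank_one_eq_operator_sum\<close>).\<close>

section \<open>Ancestors and directed paths in a rooted directed tree\<close>

locale rooted_tree =
  fixes V :: "'a set" and E :: "'a rel"
  assumes rooted: "rooted_directed_tree V E"
begin

lemma edges_subset: "E \<subseteq> V \<times> V" and acyclic_E: "acyclic E"
  using rooted unfolding rooted_directed_tree_def directed_tree_def by auto

lemma parent_unique: "(p, v) \<in> E \<Longrightarrow> (q, v) \<in> E \<Longrightarrow> p = q"
proof -
  assume pq: "(p, v) \<in> E" "(q, v) \<in> E"
  then have "v \<in> V - tree_roots V E"
    using edges_subset unfolding tree_roots_def by auto
  then show "p = q"
    using rooted pq unfolding rooted_directed_tree_def directed_tree_def by blast
qed

lemma rtrancl_antisym: "(x, y) \<in> E\<^sup>* \<Longrightarrow> (y, x) \<in> E\<^sup>* \<Longrightarrow> x = y"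
  using acyclic_E by (meson acyclic_def rtrancl_eq_or_trancl rtrancl_trancl_trancl)

lemma trancl_iff_rtrancl: "(x, y) \<in> E\<^sup>+ \<longleftrightarrow> (x, y) \<in> E\<^sup>* \<and> x \<noteq> y"
  using acyclic_E by (metis acyclic_def rtrancl_eq_or_trancl)

lemma rtrancl_in_V: "(x, y) \<in> E\<^sup>* \<Longrightarrow> x \<in> V \<longleftrightarrow> y \<in> V"
  by (induction rule: rtrancl_induct) (use edges_subset in auto)

lemma ancestors_comparable:
  assumes "(x, z) \<in> E\<^sup>*" "(y, z) \<in> E\<^sup>*"
  shows "(x, y) \<in> E\<^sup>* \<or> (y, x) \<in> E\<^sup>*"
proof -
  have "single_valued (E\<inverse>)"
    using parent_unique by (auto simp: single_valued_def)
  then have "(x, y) \<in> (E\<inverse>)\<^sup>* \<or> (y, x) \<in> (E\<inverse>)\<^sup>*"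
    using assms by (intro single_valued_confluent) (auto simp: rtrancl_converse)
  then show ?thesis by (auto simp: rtrancl_converse)
qed

lemma par_eq_Some_iff: "par E v = Some p \<longleftrightarrow> (p, v) \<in> E"
proof -
  have "(THE p. (p, v) \<in> E) = q" if "(q, v) \<in> E" for q
    using that parent_unique by blast
  then show ?thesis unfolding par_def by auto
qed

lemma par_pow_eq_Some_iff: "par_pow E n v = Some w \<longleftrightarrow> (w, v) \<in> E ^^ n"
proof (induction n arbitrary: w)
  case (Suc n)
  have "par_pow E (Suc n) v = Some w \<longleftrightarrow> (\<exists>x. (x, v) \<in> E ^^ n \<and> (w, x) \<in> E)"
    by (auto simp: bind_eq_Some_conv Suc.IH par_eq_Some_iff)
  also have "\<dots> \<longleftrightarrow> (w, v) \<in> E ^^ Suc n"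
    using relpow_Suc_D2 relpow_Suc_I2 by metis
  finally show ?case .
qed auto

lemma Asc_iff: "w \<in> Asc E v \<longleftrightarrow> (w, v) \<in> E\<^sup>+"
  unfolding Asc_def par_pow_eq_Some_iff trancl_power by (auto simp: Suc_le_eq)

lemma Des_iff: "u \<in> V \<Longrightarrow> v \<in> Des V E u \<longleftrightarrow> (u, v) \<in> E\<^sup>*"
  unfolding Des_def using rtrancl_in_V by auto

lemma is_dipath_snoc:
  "is_dipath E x y (p @ [z]) \<longleftrightarrow>
     z = y \<and> (if p = [] then x = y else is_dipath E x (last p) p \<and> (last p, y) \<in> E)"
  unfolding is_dipath_def by (auto simp: successively_append_iff)

lemma is_dipath_relpow: "is_dipath E x y p \<Longrightarrow> (x, y) \<in> E ^^ (length p - 1)"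
proof (induction p arbitrary: y rule: rev_induct)
  case (snoc z p)
  show ?case
  proof (cases "p = []")
    case False
    then have "(x, last p) \<in> E ^^ (length p - 1)" "(last p, y) \<in> E"
      using snoc by (auto simp: is_dipath_snoc)
    then have "(x, y) \<in> E ^^ Suc (length p - 1)" by auto
    then show ?thesis using False by simp
  qed (use snoc in \<open>auto simp: is_dipath_def\<close>)
qed (simp add: is_dipath_def)

lemma is_dipath_exists: "(x, y) \<in> E ^^ n \<Longrightarrow> \<exists>p. is_dipath E x y p \<and> length p = Suc n"
proof (induction n arbitrary: y)
  case 0
  then have "is_dipath E x y [x]" by (simp add: is_dipath_def)
  then show ?case by fastforce
next
  case (Suc n)
  then obtain z where z: "(x, z) \<in> E ^^ n" "(z, y) \<in> E" by auto
  then obtain p where p: "is_dipath E x z p" "length p = Suc n" using Suc.IH by blast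
  then have "p \<noteq> []" "last p = z" by (auto simp: is_dipath_def)
  then have "is_dipath E x y (p @ [y])" using p z by (simp add: is_dipath_snoc)
  then show ?case using p by (intro exI[of _ "p @ [y]"]) simp
qed

text \<open>The paths are compared from their ends, because every step back is forced: a vertex has only
  one parent. Neither path can stop before the other, since it has reached \<open>x\<close> then and the
  rest of the other one would be a circuit through \<open>x\<close>.\<close>

lemma is_dipath_unique: "is_dipath E x y p \<Longrightarrow> is_dipath E x y q \<Longrightarrow> p = q"
proof (induction p arbitrary: y q rule: rev_induct)
  case Nil
  then show ?case by (simp add: is_dipath_def)
next
  case (snoc z p)
  obtain q' where q: "q = q' @ [y]"
    using snoc.prems(2) by (metis append_butlast_last_id is_dipath_def)
  have zy: "z = y" using snoc.prems(1) by (simp add: is_dipath_snoc)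
  have no_cycle: False if "is_dipath E x (last r) r" "(last r, y) \<in> E" "x = y" for r
  proof -
    have "(x, last r) \<in> E\<^sup>*" using is_dipath_relpow[OF that(1)] relpow_imp_rtrancl by blast
    then have "(y, y) \<in> E\<^sup>+" using that by (metis rtrancl_into_trancl1)
    then show False using acyclic_E by (simp add: acyclic_def)
  qed
  show ?case
  proof (cases "p = [] \<or> q' = []")
    case True
    then show ?thesis
      using snoc.prems no_cycle zy q by (auto simp: is_dipath_snoc split: if_splits)
  next
    case False
    then have "is_dipath E x (last p) p" "(last p, y) \<in> E"
      "is_dipath E x (last q') q'" "(last q', y) \<in> E"
      using snoc.prems q by (auto simp: is_dipath_snoc)
    moreover from this have "last p = last q'" using parent_unique by blast
    ultimately show ?thesis using snoc.IH zy q by auto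
  qed
qed

lemma dipath_eq: "is_dipath E x y p \<Longrightarrow> dipath E x y = p"
  unfolding dipath_def using is_dipath_unique by blast

lemma set_dipath: "is_dipath E x y p \<Longrightarrow> set p = {w. (x, w) \<in> E\<^sup>* \<and> (w, y) \<in> E\<^sup>*}"
proof (induction p arbitrary: y rule: rev_induct)
  case Nil
  then show ?case by (simp add: is_dipath_def)
next
  case (snoc z p)
  have zy: "z = y" using snoc.prems by (simp add: is_dipath_snoc)
  show ?case
  proof (cases "p = []")
    case True
    then have "x = y" using snoc.prems by (auto simp: is_dipath_def)
    then show ?thesis using True zy rtrancl_antisym by auto
  next
    case False
    then have p: "is_dipath E x (last p) p" "(last p, y) \<in> E"
      using snoc.prems by (auto simp: is_dipath_snoc)
    have "(x, last p) \<in> E\<^sup>*" using is_dipath_relpow[OF p(1)] relpow_imp_rtrancl by blast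
    then have xy: "(x, y) \<in> E\<^sup>*" using p(2) by simp
    have "(w, y) \<in> E\<^sup>* \<longleftrightarrow> w = y \<or> (w, last p) \<in> E\<^sup>*" for w
    proof
      assume "(w, y) \<in> E\<^sup>*"
      then show "w = y \<or> (w, last p) \<in> E\<^sup>*"
        by (cases rule: rtranclE) (use parent_unique p(2) in auto)
    next
      assume "w = y \<or> (w, last p) \<in> E\<^sup>*"
      then show "(w, y) \<in> E\<^sup>*" using p(2) by auto
    qed
    then show ?thesis using snoc.IH[OF p(1)] zy xy by auto
  qed
qed

lemma seg_eq: "(x, y) \<in> E\<^sup>* \<Longrightarrow> seg E x y = {w. (x, w) \<in> E\<^sup>* \<and> (w, y) \<in> E\<^sup>*}"
  unfolding seg_def by (metis dipath_eq set_dipath is_dipath_exists rtrancl_imp_relpow)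

lemma seg_self: "seg E x x = {x}"
  using seg_eq[of x x] rtrancl_antisym by auto

text \<open>The descendants of the root are closed under passing to parents, since no edge ends in the
  root; they are closed under passing to children anyway. By connectedness they are all of
  the vertices.\<close>

lemma root_reaches:
  assumes "v \<in> V"
  shows "(tree_root V E, v) \<in> E\<^sup>*"
proof -
  define r where "r = tree_root V E"
  have r: "r \<in> tree_roots V E"
    using rooted theI'[of "\<lambda>r. r \<in> tree_roots V E"]
    unfolding rooted_directed_tree_def r_def tree_root_def by blast
  then have "r \<in> V" "\<And>p. (p, r) \<notin> E" by (auto simp: tree_roots_def)
  have "(r, v) \<in> (E \<union> E\<inverse>)\<^sup>*"
    using rooted \<open>r \<in> V\<close> assms unfolding rooted_directed_tree_def directed_tree_def by blast
  then have "(r, v) \<in> E\<^sup>*"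
  proof (induction rule: rtrancl_induct)
    case (step y z)
    show ?case
    proof (cases "(y, z) \<in> E")
      case False
      then have "(z, y) \<in> E" using step by auto
      then show ?thesis
        using \<open>(r, y) \<in> E\<^sup>*\<close> \<open>\<And>p. (p, r) \<notin> E\<close> parent_unique by (metis rtranclE)
    qed (use step in auto)
  qed simp
  then show ?thesis by (simp add: r_def)
qed

text \<open>All ancestors lie on the path from the root.\<close>

lemma finite_ancestors: "v \<in> V \<Longrightarrow> finite {w. (w, v) \<in> E\<^sup>*}"
proof -
  assume v: "v \<in> V"
  have "{w. (w, v) \<in> E\<^sup>*} \<subseteq> seg E (tree_root V E) v"
    using seg_eq[OF root_reaches[OF v]] root_reaches rtrancl_in_V v by auto
  then show ?thesis by (rule finite_subset) (simp add: seg_def)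
qed

lemma depth_eq: "(tree_root V E, v) \<in> E ^^ n \<Longrightarrow> depth V E v = n"
  using is_dipath_exists dipath_eq unfolding depth_def by fastforce

lemma depth_less: "(x, y) \<in> E\<^sup>+ \<Longrightarrow> depth V E x < depth V E y"
proof -
  assume xy: "(x, y) \<in> E\<^sup>+"
  then obtain k where k: "k > 0" "(x, y) \<in> E ^^ k" using trancl_power by blast
  have "x \<in> V" using xy edges_subset by (meson SigmaD1 subsetD tranclD)
  then obtain n where n: "(tree_root V E, x) \<in> E ^^ n"
    using root_reaches rtrancl_imp_relpow by blast
  then have "(tree_root V E, y) \<in> E ^^ (n + k)" using k by (auto simp: relpow_add)
  then show ?thesis using depth_eq n k by fastforce
qed

text \<open>For comparable vertices the candidates for the meet are the ancestors-or-self of the upper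
  one, among which that vertex itself is the deepest.\<close>

lemma meet_eq:
  assumes "y \<in> V" "(y, x) \<in> E\<^sup>*"
  shows "meet V E x y = y" and "meet V E y x = y"
proof -
  have iff: "(\<exists>m n. par_pow E n s = Some w \<and> par_pow E m t = Some w) \<longleftrightarrow>
      (w, s) \<in> E\<^sup>* \<and> (w, t) \<in> E\<^sup>*" for w s t
    by (auto simp: par_pow_eq_Some_iff rtrancl_power)
  have deepest: "(ARG_MAX (depth V E) w. P w) = y"
    if P: "\<And>w. P w \<longleftrightarrow> (w, y) \<in> E\<^sup>*" for P
  proof -
    have "is_arg_max (depth V E) P y"
      using P depth_less trancl_iff_rtrancl unfolding is_arg_max_def
      by (metis rtrancl.rtrancl_refl not_less_iff_gr_or_eq)
    moreover have "z = y" if "is_arg_max (depth V E) P z" for z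
      using that P depth_less trancl_iff_rtrancl unfolding is_arg_max_def
      by (metis rtrancl.rtrancl_refl)
    ultimately show ?thesis unfolding arg_max_def by blast
  qed
  show "meet V E x y = y" "meet V E y x = y"
    unfolding meet_def iff
    by (rule deepest; use assms rtrancl_in_V in \<open>auto intro: rtrancl_trans\<close>)+
qed

section \<open>The join with a fixed vertex\<close>

lemma ext_edges_rtrancl_iff:
  "(Vert x, Vert y) \<in> (ext_edges V E)\<^sup>* \<longleftrightarrow> (x, y) \<in> E\<^sup>*"
proof
  assume "(Vert x, Vert y) \<in> (ext_edges V E)\<^sup>*"
  then show "(x, y) \<in> E\<^sup>*"
  proof (induction "Vert y" arbitrary: y rule: rtrancl_induct)
    case (step z)
    then obtain z' where "z = Vert z'" "(z', y) \<in> E" by (auto simp: ext_edges_def)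
    then show ?case using step.hyps(3)[of z'] by auto
  qed simp
next
  assume "(x, y) \<in> E\<^sup>*"
  then show "(Vert x, Vert y) \<in> (ext_edges V E)\<^sup>*"
  proof (induction rule: rtrancl_induct)
    case (step y z)
    then have "(Vert y, Vert z) \<in> ext_edges V E" by (auto simp: ext_edges_def)
    then show ?case using step by auto
  qed simp
qed

lemma join_Vert:
  "join V E (Vert u) (Vert v) =
     (if (v, u) \<in> E\<^sup>* then Vert u else if (u, v) \<in> E\<^sup>* then Vert v else Infty)"
  unfolding join_def ext_edges_rtrancl_iff by simp

lemma mem_A_set:
  assumes "u \<in> V" "b \<in> V"
  shows "v \<in> A_set V E b u \<longleftrightarrow>
    (if (u, b) \<in> E\<^sup>* then (u, v) \<in> E\<^sup>* \<and> (v, b) \<in> E\<^sup>* else (v, u) \<in> E\<^sup>* \<or> v = b)"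
  using assms by (auto simp: A_set_def Des_iff seg_eq Asc_iff trancl_iff_rtrancl)

lemma mem_diag_support:
  assumes "u \<in> V" "b \<in> V"
  shows "v \<in> diag_support V E b u \<longleftrightarrow>
    (if (u, b) \<in> E\<^sup>* then (v, u) \<in> E\<^sup>+ \<or> (u, v) \<in> E\<^sup>* \<and> (v, b) \<notin> E\<^sup>* else (u, v) \<in> E\<^sup>+)"
  using assms
  by (auto simp: diag_support_def Des_off_def Des_iff seg_eq seg_self Asc_iff trancl_iff_rtrancl)

lemma A_set_facts:
  assumes "u \<in> V" "b \<in> V"
  shows "finite (A_set V E b u)" "A_set V E b u \<subseteq> V" "diag_support V E b u \<subseteq> V"
    "A_set V E b u \<inter> diag_support V E b u = {}" "u \<in> A_set V E b u"
proof -
  show "finite (A_set V E b u)"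
    by (rule finite_subset[of _ "insert b ({w. (w, b) \<in> E\<^sup>*} \<union> {w. (w, u) \<in> E\<^sup>*})"])
      (use assms finite_ancestors in \<open>auto simp: mem_A_set split: if_splits\<close>)
  show "A_set V E b u \<subseteq> V"
  proof
    fix v assume "v \<in> A_set V E b u"
    then have "(u, v) \<in> E\<^sup>* \<or> (v, u) \<in> E\<^sup>* \<or> v = b"
      using assms by (auto simp: mem_A_set split: if_splits)
    then show "v \<in> V" using rtrancl_in_V assms by blast
  qed
  show "diag_support V E b u \<subseteq> V"
  proof
    fix v assume "v \<in> diag_support V E b u"
    then have "(v, u) \<in> E\<^sup>* \<or> (u, v) \<in> E\<^sup>*"
      using assms by (auto simp: mem_diag_support trancl_iff_rtrancl split: if_splits)
    then show "v \<in> V" using rtrancl_in_V assms(1) by blast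
  qed
  show "A_set V E b u \<inter> diag_support V E b u = {}"
    using assms rtrancl_antisym
    by (auto simp: mem_diag_support mem_A_set trancl_iff_rtrancl split: if_splits)
  show "u \<in> A_set V E b u"
    using assms by (simp add: mem_A_set)
qed

text \<open>The combinatorial heart of the decomposition: \<open>v \<mapsto> u \<squnion>\<^sub>b v\<close> collapses \<open>A\<^sub>u\<close> to \<open>u\<close>, fixes the
  diagonal part pointwise and sends everything else to infinity. If \<open>b\<close> is a descendant of \<open>u\<close>,
  the vertices of \<open>Asc b\<close> are comparable to \<open>u\<close>, so that the meet keeps those above \<open>u\<close> and
  collapses those between \<open>u\<close> and \<open>b\<close>; outside \<open>Asc b \<union> {b}\<close> no vertex lies above \<open>u\<close>, and the
  ordinary join only keeps descendants. If \<open>b\<close> is not a descendant, the meet never occurs; the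
  ordinary join collapses \<open>u\<close> and its ancestors, and \<open>b\<close> goes to \<open>u\<close> by definition of \<open>\<squnion>\<^sub>b\<close>.\<close>

lemma join_at_eq:
  assumes "u \<in> V" "b \<in> V" "b \<noteq> u"
  shows "join_at V E b (Vert u) (Vert v) =
    (if v \<in> A_set V E b u then Vert u
     else if v \<in> diag_support V E b u then Vert v else Infty)"
proof (cases "(u, b) \<in> E\<^sup>*")
  case True
  then have ub: "(u, b) \<in> E\<^sup>+" using assms by (simp add: trancl_iff_rtrancl)
  show ?thesis
  proof (cases "(v, b) \<in> E\<^sup>*")
    case vb: True
    have vV: "v \<in> V" using vb rtrancl_in_V assms by blast
    show ?thesis
    proof (cases "(u, v) \<in> E\<^sup>*")
      case uv: True
      then show ?thesis
        using vb True assms meet_eq(2)[OF assms(1) uv] ub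
        by (auto simp: join_at_def mem_A_set image_iff Asc_iff trancl_iff_rtrancl)
    next
      case False
      then have vu: "(v, u) \<in> E\<^sup>*" using ancestors_comparable[OF vb True] by blast
      then have "v \<noteq> b" using True False by auto
      then show ?thesis
        using vb False vu True assms meet_eq(1)[OF vV vu]
        by (auto simp: join_at_def mem_A_set mem_diag_support image_iff Asc_iff trancl_iff_rtrancl)
    qed
  next
    case False
    then have "(v, u) \<notin> E\<^sup>*" "v \<noteq> b" using True by (auto dest: rtrancl_trans)
    then show ?thesis
      using False True assms
      by (auto simp: join_at_def join_Vert mem_A_set mem_diag_support image_iff Asc_iff
          trancl_iff_rtrancl)
  qed
next
  case False
  then show ?thesis
    using assms
    by (auto simp: join_at_def join_Vert mem_A_set mem_diag_support image_iff Asc_iff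
        trancl_iff_rtrancl)
qed

text \<open>The fibre of \<open>v \<mapsto> u \<squnion>\<^sub>b v\<close> is \<open>A\<^sub>u\<close> over \<open>u\<close>, the singleton \<open>{w}\<close> over a vertex \<open>w\<close> of the
  diagonal part, and empty over every other vertex.\<close>

lemma join_map_eq:
  assumes "u \<in> V" "b \<in> V" "b \<noteq> u"
  shows "join_map V E b u lam f =
    (\<lambda>w. if w \<in> diag_support V E b u then lam (Vert w) * f w else 0) +
    cscale (\<Sum>v\<in>A_set V E b u. lam (Vert v) * f v) (basis_vec u)"
proof
  fix w
  note A = A_set_facts[OF assms(1,2)]
  have fibre: "{v \<in> V. join_at V E b (Vert u) (Vert v) = Vert w} =
      (if w = u then A_set V E b u else if w \<in> diag_support V E b u then {w} else {})"
    using A by (auto simp: join_at_eq[OF assms] split: if_splits)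
  have "u \<notin> diag_support V E b u" using A by blast
  moreover have "w \<in> V" if "w = u \<or> w \<in> diag_support V E b u" using that A assms by blast
  ultimately show "join_map V E b u lam f w =
    ((\<lambda>w. if w \<in> diag_support V E b u then lam (Vert w) * f w else 0) +
     cscale (\<Sum>v\<in>A_set V E b u. lam (Vert v) * f v) (basis_vec u)) w"
    using A(1) unfolding join_map_def fibre by (auto simp: cscale_def basis_vec_def)
qed

end

section \<open>Square-summable functions and their coordinate subspaces\<close>

lemma ell2_mono: "W \<subseteq> V \<Longrightarrow> ell2 W \<subseteq> ell2 V"
  by (auto simp: ell2_def)

lemma ell2_zero: "0 \<in> ell2 W"
  by (simp add: ell2_def)

lemma ell2_dominated:
  assumes "f \<in> ell2 V" "\<And>v. cmod (g v) \<le> cmod (f v)" "\<And>v. v \<notin> W \<Longrightarrow> g v = 0"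
  shows "g \<in> ell2 W"
proof -
  have "(\<lambda>v. (cmod (g v))\<^sup>2) summable_on UNIV"
    by (rule summable_on_comparison_test[of "\<lambda>v. (cmod (f v))\<^sup>2"])
      (use assms in \<open>auto simp: ell2_def power_mono\<close>)
  then show ?thesis using assms by (simp add: ell2_def)
qed

lemma ell2_restrict: "f \<in> ell2 V \<Longrightarrow> (\<lambda>v. if v \<in> W then f v else 0) \<in> ell2 W"
  by (rule ell2_dominated) auto

lemma ell2_add:
  assumes "f \<in> ell2 W" "g \<in> ell2 W"
  shows "f + g \<in> ell2 W"
proof -
  have bound: "(cmod (f v + g v))\<^sup>2 \<le> 2 * (cmod (f v))\<^sup>2 + 2 * (cmod (g v))\<^sup>2" for v
  proof -
    have "(cmod (f v + g v))\<^sup>2 \<le> (cmod (f v) + cmod (g v))\<^sup>2"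
      by (simp add: norm_triangle_ineq power_mono)
    also have "\<dots> \<le> 2 * (cmod (f v))\<^sup>2 + 2 * (cmod (g v))\<^sup>2"
      using sum_squares_bound[of "cmod (f v)" "cmod (g v)"] by (simp add: power2_sum)
    finally show ?thesis .
  qed
  have "(\<lambda>v. 2 * (cmod (f v))\<^sup>2 + 2 * (cmod (g v))\<^sup>2) summable_on UNIV"
    using assms by (intro summable_on_add summable_on_cmult_right) (auto simp: ell2_def)
  then have "(\<lambda>v. (cmod (f v + g v))\<^sup>2) summable_on UNIV"
    by (rule summable_on_comparison_test) (use bound in auto)
  then show ?thesis using assms by (simp add: ell2_def)
qed

lemma ell2_cscale: "f \<in> ell2 W \<Longrightarrow> cscale c f \<in> ell2 W"
  by (auto simp: ell2_def cscale_def norm_mult power_mult_distrib intro!: summable_on_cmult_right)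

lemma ell2_finite_support:
  assumes "finite F" "F \<subseteq> W" "\<And>v. v \<notin> F \<Longrightarrow> f v = 0"
  shows "f \<in> ell2 W"
proof -
  have "(\<lambda>v. (cmod (f v))\<^sup>2) summable_on UNIV \<longleftrightarrow> (\<lambda>v. (cmod (f v))\<^sup>2) summable_on F"
    by (rule summable_on_cong_neutral) (use assms in auto)
  then show ?thesis using assms by (auto simp: ell2_def)
qed

lemma infsum_finite_support:
  assumes "finite F" "\<And>v. v \<notin> F \<Longrightarrow> f v = 0"
  shows "infsum f UNIV = sum f F"
proof -
  have "infsum f UNIV = infsum f F" by (rule infsum_cong_neutral) (use assms in auto)
  then show ?thesis using assms by simp
qed

lemma basis_vec_ell2: "v \<in> W \<Longrightarrow> basis_vec v \<in> ell2 W"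
  by (rule ell2_finite_support[of "{v}"]) (auto simp: basis_vec_def)

lemma ell2_inner_basis_vec: "ell2_inner g (basis_vec w) = g w"
  unfolding ell2_inner_def
  by (subst infsum_finite_support[of "{w}"]) (auto simp: basis_vec_def)

lemma ell2_norm_cscale_basis_vec: "ell2_norm (cscale c (basis_vec w)) = cmod c"
  unfolding ell2_norm_def
  by (subst infsum_finite_support[of "{w}"]) (auto simp: basis_vec_def cscale_def)

lemma cmod_le_ell2_norm:
  assumes "f \<in> ell2 W"
  shows "cmod (f v) \<le> ell2_norm f"
proof -
  have "(\<Sum>v\<in>{v}. (cmod (f v))\<^sup>2) \<le> (\<Sum>\<^sub>\<infinity>v. (cmod (f v))\<^sup>2)"
    by (rule finite_sum_le_infsum) (use assms in \<open>auto simp: ell2_def\<close>)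
  then show ?thesis unfolding ell2_norm_def by (simp add: real_le_rsqrt)
qed

text \<open>Testing against the basis vectors of \<open>W\<close> shows that a function orthogonal to \<open>ell2 W\<close>
  vanishes on \<open>W\<close>.\<close>

lemma ominus_ell2:
  assumes "W \<subseteq> V"
  shows "ominus (ell2 V) (ell2 W) = ell2 (V - W)"
proof
  show "ominus (ell2 V) (ell2 W) \<subseteq> ell2 (V - W)"
  proof
    fix g assume g: "g \<in> ominus (ell2 V) (ell2 W)"
    then have "g w = 0" if "w \<in> W" for w
      using that basis_vec_ell2[OF that] ell2_inner_basis_vec[of g w] by (auto simp: ominus_def)
    then show "g \<in> ell2 (V - W)" using g by (auto simp: ominus_def ell2_def)
  qed
next
  show "ell2 (V - W) \<subseteq> ominus (ell2 V) (ell2 W)"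
  proof
    fix g assume g: "g \<in> ell2 (V - W)"
    have "ell2_inner g f = 0" if "f \<in> ell2 W" for f
    proof -
      have "(\<lambda>v. g v * cnj (f v)) = (\<lambda>v. 0)" using g that by (auto simp: ell2_def fun_eq_iff)
      then show ?thesis by (simp add: ell2_inner_def)
    qed
    then show "g \<in> ominus (ell2 V) (ell2 W)"
      using g ell2_mono[of "V - W" V] by (auto simp: ominus_def)
  qed
qed

lemma ell2_decomp:
  assumes "W \<subseteq> V"
  shows "ell2 V = {f + g |f g. f \<in> ell2 W \<and> g \<in> ell2 (V - W)}"
proof
  show "ell2 V \<subseteq> {f + g |f g. f \<in> ell2 W \<and> g \<in> ell2 (V - W)}"
  proof
    fix f assume f: "f \<in> ell2 V"
    have "f = (\<lambda>v. if v \<in> W then f v else 0) + (\<lambda>v. if v \<in> V - W then f v else 0)"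
      using f by (auto simp: fun_eq_iff ell2_def)
    then show "f \<in> {f + g |f g. f \<in> ell2 W \<and> g \<in> ell2 (V - W)}"
      using ell2_restrict[OF f] by blast
  qed
  show "{f + g |f g. f \<in> ell2 W \<and> g \<in> ell2 (V - W)} \<subseteq> ell2 V"
    using ell2_mono[OF assms] ell2_mono[of "V - W" V] by (auto intro!: ell2_add)
qed

section \<open>Diagonal and rank one operators\<close>

lemma diag_op_eq:
  "diag_op W \<mu> = {(f, \<lambda>v. \<mu> v * f v) |f. f \<in> ell2 W \<and> (\<lambda>v. \<mu> v * f v) \<in> ell2 W}"
proof -
  have "(\<lambda>v. (cmod (f v))\<^sup>2 * (cmod (\<mu> v))\<^sup>2) summable_on W \<longleftrightarrow> (\<lambda>v. \<mu> v * f v) \<in> ell2 W"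
    if f: "f \<in> ell2 W" for f
  proof -
    have "(\<lambda>v. (cmod (f v))\<^sup>2 * (cmod (\<mu> v))\<^sup>2) summable_on W \<longleftrightarrow>
        (\<lambda>v. (cmod (\<mu> v * f v))\<^sup>2) summable_on UNIV"
      by (rule summable_on_cong_neutral)
        (use f in \<open>auto simp: ell2_def norm_mult power_mult_distrib\<close>)
    then show ?thesis using f by (auto simp: ell2_def)
  qed
  then show ?thesis unfolding diag_op_def by auto
qed

lemma linear_diag_op: "linear_operator_in (ell2 W) (diag_op W \<mu>)"
proof -
  have add: "(\<lambda>v. \<mu> v * (f + g) v) = (\<lambda>v. \<mu> v * f v) + (\<lambda>v. \<mu> v * g v)" for f g
    by (simp add: fun_eq_iff distrib_left)
  have scale: "(\<lambda>v. \<mu> v * cscale c f v) = cscale c (\<lambda>v. \<mu> v * f v)" for c f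
    by (simp add: fun_eq_iff cscale_def)
  have zero: "(\<lambda>v. \<mu> v * 0 v) = 0"
    by (simp add: fun_eq_iff)
  have "(f + g, f' + g') \<in> diag_op W \<mu>" if "(f, f') \<in> diag_op W \<mu>" "(g, g') \<in> diag_op W \<mu>"
    for f f' g g'
    using that unfolding diag_op_eq by (auto simp del: plus_fun_apply simp: add intro: ell2_add)
  moreover have "(cscale c f, cscale c f') \<in> diag_op W \<mu>" if "(f, f') \<in> diag_op W \<mu>" for c f f'
    using that ell2_cscale unfolding diag_op_eq by (auto simp: scale)
  moreover have "(0, 0) \<in> diag_op W \<mu>"
    unfolding diag_op_eq using zero ell2_zero by auto
  moreover have "diag_op W \<mu> \<subseteq> ell2 W \<times> ell2 W" "single_valued (diag_op W \<mu>)"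
    by (auto simp: diag_op_eq single_valued_def)
  ultimately show ?thesis unfolding linear_operator_in_def by blast
qed

text \<open>The finitely supported functions lie in the domain whatever the multiplier is, and
  truncations of a square-summable function to large finite sets approximate it.\<close>

lemma diag_op_dense: "densely_defined_in (ell2 W) (diag_op W \<mu>)"
proof -
  have "\<exists>g\<in>Domain (diag_op W \<mu>). ell2_norm (f - g) < \<epsilon>" if f: "f \<in> ell2 W" and "\<epsilon> > 0" for f \<epsilon>
  proof -
    let ?s = "\<lambda>v. (cmod (f v))\<^sup>2"
    have sum: "?s summable_on UNIV" using f by (simp add: ell2_def)
    have "\<epsilon>\<^sup>2 > 0" using \<open>\<epsilon> > 0\<close> by simp
    then obtain F where F: "finite F" "dist (sum ?s F) (infsum ?s UNIV) \<le> \<epsilon>\<^sup>2 / 2"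
      using infsum_finite_approximation[OF sum, of "\<epsilon>\<^sup>2 / 2"] by auto
    define g where "g = (\<lambda>v. if v \<in> F then f v else 0)"
    have "g \<in> ell2 W" "(\<lambda>v. \<mu> v * g v) \<in> ell2 W"
      by (rule ell2_finite_support[of "F \<inter> W"]; use f F(1) in \<open>auto simp: g_def ell2_def\<close>)+
    then have "g \<in> Domain (diag_op W \<mu>)" unfolding diag_op_eq by blast
    moreover have "ell2_norm (f - g) < \<epsilon>"
    proof -
      have "(\<Sum>\<^sub>\<infinity>v. (cmod ((f - g) v))\<^sup>2) = infsum ?s (UNIV - F)"
        by (rule infsum_cong_neutral) (auto simp: g_def)
      also have "\<dots> = infsum ?s UNIV - sum ?s F"
        using infsum_Diff[OF sum summable_on_finite[OF F(1)]] F(1) by simp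
      also have "\<dots> < \<epsilon>\<^sup>2" using F(2) \<open>\<epsilon>\<^sup>2 > 0\<close> unfolding dist_real_def by linarith
      finally show ?thesis
        unfolding ell2_norm_def using \<open>\<epsilon> > 0\<close> by (intro real_less_lsqrt) auto
    qed
    ultimately show ?thesis by blast
  qed
  moreover have "Domain (diag_op W \<mu>) \<subseteq> ell2 W" by (auto simp: diag_op_eq)
  ultimately show ?thesis unfolding densely_defined_in_def by blast
qed

lemma diag_op_restrict:
  assumes "W \<subseteq> V"
  shows "diag_op W \<mu> \<subseteq> diag_op V \<mu>"
    and "Domain (diag_op W \<mu>) = {f \<in> ell2 W. \<exists>g\<in>ell2 W. (f, g) \<in> diag_op V \<mu>}"
  using ell2_mono[OF assms] unfolding diag_op_eq by blast+

lemma weight_vec_apply: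
  assumes "finite A"
  shows "weight_vec lam A w = (if w \<in> A then cnj (lam (Vert w)) else 0)"
  using assms
proof (induction A rule: finite_induct)
  case (insert x A)
  have "weight_vec lam (insert x A) w =
      cscale (cnj (lam (Vert x))) (basis_vec x) w + weight_vec lam A w"
    unfolding weight_vec_def using insert by simp
  then show ?case using insert by (auto simp: cscale_def basis_vec_def)
qed (simp add: weight_vec_def)

lemma ell2_inner_weight_vec:
  assumes "finite A"
  shows "ell2_inner h (weight_vec lam A) = (\<Sum>v\<in>A. lam (Vert v) * h v)"
  unfolding ell2_inner_def using assms
  by (subst infsum_finite_support[of A]) (auto simp: weight_vec_apply mult.commute)

text \<open>A finite sum of coordinates is bounded because each coordinate is at most the norm.\<close>

lemma bounded_rank_one_weight_vec:
  assumes "finite A" "u \<in> W"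
  shows "bounded_operator_on (ell2 W) (rank_one_op (ell2 W) (basis_vec u) (weight_vec lam A))"
    (is "bounded_operator_on _ ?N")
proof -
  let ?\<phi> = "\<lambda>h. \<Sum>v\<in>A. lam (Vert v) * h v"
  have N: "?N = {(h, cscale (?\<phi> h) (basis_vec u)) |h. h \<in> ell2 W}"
    unfolding rank_one_op_def by (simp add: ell2_inner_weight_vec[OF assms(1)])
  have \<phi>: "?\<phi> (f + g) = ?\<phi> f + ?\<phi> g" "?\<phi> (cscale c f) = c * ?\<phi> f" for f g c
    by (simp_all add: distrib_left sum.distrib cscale_def sum_distrib_left mult.left_commute)
  have cs: "cscale (a + b) x = cscale a x + cscale b x" "cscale (a * b) x = cscale a (cscale b x)"
    for a b and x :: "'a \<Rightarrow> complex"
    by (simp_all add: fun_eq_iff cscale_def distrib_right)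
  have "(f + g, f' + g') \<in> ?N" if "(f, f') \<in> ?N" "(g, g') \<in> ?N" for f f' g g'
  proof -
    have "f + g \<in> ell2 W" "f' + g' = cscale (?\<phi> (f + g)) (basis_vec u)"
      using that ell2_add unfolding N \<phi> cs by auto
    then show ?thesis unfolding N by blast
  qed
  moreover have "(cscale c f, cscale c f') \<in> ?N" if "(f, f') \<in> ?N" for c f f'
  proof -
    have "cscale c f \<in> ell2 W" "cscale c f' = cscale (?\<phi> (cscale c f)) (basis_vec u)"
      using that ell2_cscale unfolding N \<phi> cs by auto
    then show ?thesis unfolding N by blast
  qed
  moreover have "(0, 0) \<in> ?N"
    using ell2_zero[of W] unfolding N by (auto simp: cscale_def fun_eq_iff intro!: exI[of _ 0])
  moreover have "?N \<subseteq> ell2 W \<times> ell2 W"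
    using ell2_cscale[OF basis_vec_ell2[OF assms(2)]] unfolding N by auto
  moreover have "single_valued ?N" unfolding N by (auto simp: single_valued_def)
  ultimately have "linear_operator_in (ell2 W) ?N"
    unfolding linear_operator_in_def by blast
  moreover have "Domain ?N = ell2 W" unfolding N by auto
  moreover have "ell2_norm g \<le> (\<Sum>v\<in>A. cmod (lam (Vert v))) * ell2_norm f" if "(f, g) \<in> ?N" for f g
  proof -
    have f: "f \<in> ell2 W" and g: "g = cscale (?\<phi> f) (basis_vec u)" using that unfolding N by auto
    have "cmod (?\<phi> f) \<le> (\<Sum>v\<in>A. cmod (lam (Vert v)) * ell2_norm f)"
      using cmod_le_ell2_norm[OF f] by (intro sum_norm_le) (simp add: norm_mult mult_left_mono)
    then show ?thesis by (simp add: g ell2_norm_cscale_basis_vec sum_distrib_right)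
  qed
  ultimately show ?thesis unfolding bounded_operator_on_def by blast
qed

lemma rank_one_op_rank: "rank_at_most 1 (rank_one_op K x y)"
proof -
  interpret module "cscale :: complex \<Rightarrow> ('a \<Rightarrow> complex) \<Rightarrow> 'a \<Rightarrow> complex"
    by unfold_locales (auto simp: cscale_def fun_eq_iff distrib_left distrib_right)
  have "cscale c x \<in> span {x}" for c
    by (rule span_scale, rule span_base) simp
  then have "Range (rank_one_op K x y) \<subseteq> span {x}"
    unfolding rank_one_op_def by blast
  then show ?thesis
    unfolding rank_at_most_def by (intro exI[of _ "{x}"]) simp
qed

text \<open>Since the rank one summand only adds a multiple of \<open>e\<^sub>u\<close>, square-summability of the image of
  \<open>f\<close> is a condition on the diagonal part alone; this is why the two domains agree. As \<open>A\<close> misses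
  \<open>W\<close>, the functional only sees the component of \<open>f\<close> off \<open>W\<close>.\<close>

lemma diag_plus_rank_one_eq_operator_sum:
  assumes "W \<subseteq> V" "finite A" "A \<subseteq> V - W" "u \<in> V"
    and J: "\<And>f. J f = (\<lambda>w. if w \<in> W then lam (Vert w) * f w else 0) +
                    cscale (\<Sum>v\<in>A. lam (Vert v) * f v) (basis_vec u)"
  shows "{(f, J f) |f. f \<in> ell2 V \<and> J f \<in> ell2 V} =
    operator_sum (diag_op W (\<lambda>v. lam (Vert v)))
      (rank_one_op (ell2 (V - W)) (basis_vec u) (weight_vec lam A))"
    (is "?T = ?S")
proof -
  let ?\<mu> = "\<lambda>v. lam (Vert v)"
  let ?D = "\<lambda>f w. if w \<in> W then lam (Vert w) * f w else 0"
  let ?\<phi> = "\<lambda>h. \<Sum>v\<in>A. lam (Vert v) * h v"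
  have eu: "cscale c (basis_vec u) \<in> ell2 V" for c
    by (rule ell2_cscale[OF basis_vec_ell2[OF assms(4)]])
  have J_split: "J (g + h) = (\<lambda>v. ?\<mu> v * g v) + cscale (?\<phi> h) (basis_vec u)"
    if "g \<in> ell2 W" "h \<in> ell2 (V - W)" for g h
  proof -
    have "?D (g + h) = (\<lambda>v. ?\<mu> v * g v)" using that by (auto simp: fun_eq_iff ell2_def)
    moreover have "?\<phi> (g + h) = ?\<phi> h"
      using that assms(3) by (intro sum.cong) (auto simp: ell2_def)
    ultimately show ?thesis unfolding J by simp
  qed
  have diag_iff: "J (g + h) \<in> ell2 V \<longleftrightarrow> (\<lambda>v. ?\<mu> v * g v) \<in> ell2 W"
    if "g \<in> ell2 W" "h \<in> ell2 (V - W)" for g h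
  proof
    assume "J (g + h) \<in> ell2 V"
    \<comment> \<open>Cancelling the rank one part leaves the diagonal part.\<close>
    then have "J (g + h) + cscale (- ?\<phi> h) (basis_vec u) \<in> ell2 V"
      by (rule ell2_add[OF _ eu])
    also have "J (g + h) + cscale (- ?\<phi> h) (basis_vec u) = (\<lambda>v. ?\<mu> v * g v)"
      unfolding J_split[OF that] by (simp add: fun_eq_iff cscale_def)
    finally have "(\<lambda>v. ?\<mu> v * g v) \<in> ell2 V" .
    then show "(\<lambda>v. ?\<mu> v * g v) \<in> ell2 W"
      by (rule ell2_dominated) (use that in \<open>auto simp: ell2_def\<close>)
  next
    assume "(\<lambda>v. ?\<mu> v * g v) \<in> ell2 W"
    then show "J (g + h) \<in> ell2 V"
      unfolding J_split[OF that] by (intro ell2_add[OF _ eu] subsetD[OF ell2_mono[OF assms(1)]])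
  qed
  \<comment> \<open>Every \<open>f\<close> is written as \<open>g + h\<close> with \<open>g\<close> supported in \<open>W\<close> and \<open>h\<close> off \<open>W\<close>.\<close>
  have "?T = {(g + h, J (g + h)) |g h. g \<in> ell2 W \<and> h \<in> ell2 (V - W) \<and> J (g + h) \<in> ell2 V}"
    unfolding ell2_decomp[OF assms(1)] by blast
  also have "\<dots> = {(g + h, (\<lambda>v. ?\<mu> v * g v) + cscale (?\<phi> h) (basis_vec u)) |g h.
      g \<in> ell2 W \<and> h \<in> ell2 (V - W) \<and> (\<lambda>v. ?\<mu> v * g v) \<in> ell2 W}"
    using J_split diag_iff by (intro Collect_cong) (metis (no_types, lifting))
  also have "\<dots> = ?S"
    unfolding operator_sum_def diag_op_eq rank_one_op_def ell2_inner_weight_vec[OF assms(2)]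
    by blast
  finally show ?thesis .
qed

section \<open>The decomposition of a weighted join operator\<close>

theorem theorem3p13:
  fixes V :: "'a set" and E :: "'a rel" and u b :: 'a and lam :: "'a evertex \<Rightarrow> complex"
  assumes "rooted_directed_tree V E"
    and "countable V" and "infinite V"
    and "u \<in> V" and "b \<in> V - {u}"
    and "weight_system lam"
  defines "H \<equiv> ell2 (diag_support V E b u)"
  defines "K \<equiv> ominus (ell2 V) H"
  shows "H \<subseteq> ell2 V \<and> ell2 V = {f + g |f g. f \<in> H \<and> g \<in> K} \<and>
    (\<exists>D N.
       weighted_join_op V E b u lam = operator_sum D N \<and>
       linear_operator_in H D \<and> densely_defined_in H D \<and>
       diagonal_operator_in (diag_support V E b u) D \<and>
       bounded_operator_on K N \<and> rank_at_most 1 N \<and>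
       Domain D = {f \<in> H. \<exists>g\<in>H. (f, g) \<in> weight_diag_op V lam} \<and>
       (\<forall>f g. (f, g) \<in> D \<longrightarrow> (f, g) \<in> weight_diag_op V lam) \<and>
       N = rank_one_op K (basis_vec u) (weight_vec lam (A_set V E b u)))"
proof -
  interpret rooted_tree V E by unfold_locales (rule assms(1))
  let ?S = "diag_support V E b u" and ?A = "A_set V E b u"
  have b: "b \<in> V" "b \<noteq> u" using assms(5) by auto
  note A = A_set_facts[OF assms(4) b(1)]
  have K: "K = ell2 (V - ?S)" unfolding K_def H_def by (rule ominus_ell2[OF A(3)])
  define D where "D = diag_op ?S (\<lambda>v. lam (Vert v))"
  define N where "N = rank_one_op K (basis_vec u) (weight_vec lam ?A)"
  have sub: "?A \<subseteq> V - ?S" "u \<in> V - ?S" using A by auto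
  have "weighted_join_op V E b u lam = operator_sum D N"
    unfolding weighted_join_op_def D_def N_def K
    by (rule diag_plus_rank_one_eq_operator_sum[OF A(3,1) sub(1) assms(4)
          join_map_eq[OF assms(4) b]])
  moreover have "linear_operator_in H D" "densely_defined_in H D"
    unfolding H_def D_def by (rule linear_diag_op diag_op_dense)+
  moreover have "diagonal_operator_in ?S D"
    unfolding diagonal_operator_in_def D_def by blast
  moreover have "bounded_operator_on K N" "rank_at_most 1 N"
    unfolding N_def K by (rule bounded_rank_one_weight_vec[OF A(1) sub(2)] rank_one_op_rank)+
  moreover have "Domain D = {f \<in> H. \<exists>g\<in>H. (f, g) \<in> weight_diag_op V lam}"
    unfolding D_def H_def weight_diag_op_def by (rule diag_op_restrict(2)[OF A(3)])
  moreover have "\<forall>f g. (f, g) \<in> D \<longrightarrow> (f, g) \<in> weight_diag_op V lam"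
    using diag_op_restrict(1)[OF A(3)] unfolding D_def weight_diag_op_def by blast
  moreover have "H \<subseteq> ell2 V" unfolding H_def by (rule ell2_mono[OF A(3)])
  moreover have "ell2 V = {f + g |f g. f \<in> H \<and> g \<in> K}"
    unfolding K unfolding H_def by (rule ell2_decomp[OF A(3)])
  ultimately show ?thesis using N_def by blast
qed

end
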